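(* Charge-breaking and neutral minima never coexist in the two-Higgs-doublet model: if $V$ is a two-Higgs-doublet potential with parameters $M^\mu$ and $\Lambda^{\mu\nu}$ satisfying the positivity constraint, then $V$ cannot have both a charge-breaking stationary point that is a minimum and a neutral stationary point that is a minimum.
   Context: Two Higgs doublets $\phi_1,\phi_2\in\mathbb{C}^2$ are given, and the general potential is $V=-M_\mu r^\mu+\frac12\Lambda_{\mu\nu}r^\mu r^\nu$ (sum over repeated indices $0,\dots,3$), with a real four-vector $M^\mu$ and a real symmetric tensor $\Lambda^{\mu\nu}$, where $r^0=\phi_1^\dagger\phi_1+\phi_2^\dagger\phi_2$, $r^1=2\,\mathrm{Re}(\phi_1^\dagger\phi_2)$, $r^2=2\,\mathrm{Im}(\phi_1^\dagger\phi_2)$, $r^3=\phi_1^\dagger\phi_1-\phi_2^\dagger\phi_2$. Indices are raised and lowered with $g=\mathrm{diag}(1,-1,-1,-1)$. The set of all $r^\mu$ is the closed solid future light-cone $LC^+=\{r: r^0\ge 0,\ r^\mu r_\mu\ge 0\}$. Positivity constraint (standing assumption): $\Lambda_{\mu\nu}r^\mu r^\nu>0$ for every nonzero $r\in LC^+$. A stationary point is a configuration $(\phi_1,\phi_2)$ at which the gradient of $V$ with respect to the eight real fields vanishes. It is charge-breaking if $\phi_1,\phi_2$ are linearly independent (equivalently $r^\mu r_\mu>0$), and neutral if $(\phi_1,\phi_2)\ne(0,0)$ and $\phi_1,\phi_2$ are proportional (equivalently $r\neq0$, $r^\mu r_\mu=0$). $V$ is invariant under the electroweak group $U(2)$ (i.e.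 $SU(2)\times U(1)$) acting simultaneously by $\phi_i\mapsto U\phi_i$, $i=1,2$; the directions tangent to the group orbit (four at a charge-breaking point, three at a neutral point) are zero modes of the Hessian, the Goldstone modes. A stationary point is called a minimum if the eigenvalues of the Hessian of $V$ on all the remaining modes are strictly positive, i.e. the $8\times8$ Hessian is positive semidefinite with kernel exactly the tangent space of the electroweak orbit. *)

theory Defs
  imports "HOL-Analysis.Analysis"
begin

text \<open>A field configuration is a pair of doublets. The Euclidean structure of
  \<open>(complex ^ 2) \<times> (complex ^ 2)\<close> is that of the eight real fields, namely the real and
  imaginary parts of the components.\<close>

type_synonym fields = "(complex ^ 2) \<times> (complex ^ 2)"

definition dagger :: "complex ^ 2 \<Rightarrow> complex ^ 2 \<Rightarrow> complex" where
  "dagger \<phi> \<psi> = (\<Sum>i\<in>UNIV. cnj (\<phi> $ i) * \<psi> $ i)"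

text \<open>Lorentz indices are the elements \<open>0, 1, 2, 3\<close> of the four-element type \<open>4\<close>
  (in which \<open>4 = 0\<close>). Vectors and tensors are given by their contravariant components.\<close>

definition rvec :: "fields \<Rightarrow> real ^ 4" where
  "rvec \<Phi> = (let \<phi>1 = fst \<Phi>; \<phi>2 = snd \<Phi> in
     \<chi> \<mu>. if \<mu> = 0 then Re (dagger \<phi>1 \<phi>1 + dagger \<phi>2 \<phi>2)
          else if \<mu> = 1 then 2 * Re (dagger \<phi>1 \<phi>2)
          else if \<mu> = 2 then 2 * Im (dagger \<phi>1 \<phi>2)
          else Re (dagger \<phi>1 \<phi>1 - dagger \<phi>2 \<phi>2))"

definition metric :: "real ^ 4 ^ 4" where
  "metric = (\<chi> \<mu> \<nu>. if \<mu> = \<nu> then (if \<mu> = 0 then 1 else - 1) else 0)"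

definition lower :: "real ^ 4 \<Rightarrow> real ^ 4" where
  "lower x = metric *v x"

definition lower2 :: "real ^ 4 ^ 4 \<Rightarrow> real ^ 4 ^ 4" where
  "lower2 T = metric ** T ** metric"

definition LC_plus :: "(real ^ 4) set" where
  "LC_plus = {r. r $ 0 \<ge> 0 \<and> (\<Sum>\<mu>\<in>UNIV. r $ \<mu> * lower r $ \<mu>) \<ge> 0}"

definition quad :: "real ^ 4 ^ 4 \<Rightarrow> real ^ 4 \<Rightarrow> real" where
  "quad \<Lambda> r = (\<Sum>\<mu>\<in>UNIV. \<Sum>\<nu>\<in>UNIV. lower2 \<Lambda> $ \<mu> $ \<nu> * r $ \<mu> * r $ \<nu>)"

definition potential :: "real ^ 4 \<Rightarrow> real ^ 4 ^ 4 \<Rightarrow> fields \<Rightarrow> real" where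
  "potential M \<Lambda> \<Phi> =
     - (\<Sum>\<mu>\<in>UNIV. lower M $ \<mu> * rvec \<Phi> $ \<mu>) + 1 / 2 * quad \<Lambda> (rvec \<Phi>)"

definition positivity :: "real ^ 4 ^ 4 \<Rightarrow> bool" where
  "positivity \<Lambda> \<longleftrightarrow> (\<forall>r\<in>LC_plus. r \<noteq> 0 \<longrightarrow> quad \<Lambda> r > 0)"

definition gradient :: "('a::euclidean_space \<Rightarrow> real) \<Rightarrow> 'a \<Rightarrow> 'a" where
  "gradient f x = (THE D. GDERIV f x :> D)"

text \<open>The Hessian as a linear operator; its matrix in the standard basis is the usual
  matrix of second partial derivatives.\<close>

definition hessian :: "('a::euclidean_space \<Rightarrow> real) \<Rightarrow> 'a \<Rightarrow> 'a \<Rightarrow> 'a" where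
  "hessian f x = frechet_derivative (gradient f) (at x)"

definition stationary :: "real ^ 4 \<Rightarrow> real ^ 4 ^ 4 \<Rightarrow> fields \<Rightarrow> bool" where
  "stationary M \<Lambda> \<Phi> \<longleftrightarrow> GDERIV (potential M \<Lambda>) \<Phi> :> 0"

definition charge_breaking :: "fields \<Rightarrow> bool" where
  "charge_breaking \<Phi> \<longleftrightarrow>
     (\<forall>a b. a *s fst \<Phi> + b *s snd \<Phi> = 0 \<longrightarrow> a = 0 \<and> b = 0)"

definition neutral :: "fields \<Rightarrow> bool" where
  "neutral \<Phi> \<longleftrightarrow>
     \<Phi> \<noteq> 0 \<and> (\<exists>c. fst \<Phi> = c *s snd \<Phi> \<or> snd \<Phi> = c *s fst \<Phi>)"

definition conj_transpose :: "complex ^ 2 ^ 2 \<Rightarrow> complex ^ 2 ^ 2" where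
  "conj_transpose A = (\<chi> i j. cnj (A $ j $ i))"

definition U2 :: "(complex ^ 2 ^ 2) set" where
  "U2 = {U. conj_transpose U ** U = mat 1 \<and> U ** conj_transpose U = mat 1}"

definition ew_orbit :: "fields \<Rightarrow> fields set" where
  "ew_orbit \<Phi> = {(U *v fst \<Phi>, U *v snd \<Phi>) | U. U \<in> U2}"

text \<open>Velocities at \<open>\<Phi>\<close> of curves in the orbit; since the orbit is an embedded compact
  submanifold, these are exactly its tangent vectors at \<open>\<Phi>\<close>.\<close>

definition orbit_tangent :: "fields \<Rightarrow> fields set" where
  "orbit_tangent \<Phi> =
     {v. \<exists>\<gamma> :: real \<Rightarrow> fields. (\<forall>t. \<gamma> t \<in> ew_orbit \<Phi>) \<and> \<gamma> 0 = \<Phi>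
           \<and> (\<gamma> has_vector_derivative v) (at 0)}"

definition is_minimum :: "real ^ 4 \<Rightarrow> real ^ 4 ^ 4 \<Rightarrow> fields \<Rightarrow> bool" where
  "is_minimum M \<Lambda> \<Phi> \<longleftrightarrow> stationary M \<Lambda> \<Phi>
     \<and> (\<forall>v. v \<bullet> hessian (potential M \<Lambda>) \<Phi> v \<ge> 0)
     \<and> {v. hessian (potential M \<Lambda>) \<Phi> v = 0} = orbit_tangent \<Phi>"

end

theory Submission
  imports Defs
begin

text \<open>As a function of \<open>r\<close> the potential is a quadratic polynomial with symmetric matrix \<open>L\<close>;
  write \<open>p = L r - m\<close> for its gradient. At a charge-breaking configuration the map from fields
  to \<open>r\<close> is a submersion, so a minimum there has \<open>p = 0\<close> and \<open>L\<close> is positive definite. At a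
  neutral minimum, stationarity and non-negativity of the Hessian in the charged directions make \<open>p\<close> a
  null covector that is non-negative on the future light-cone and vanishes on the neutral \<open>r\<close>.
  With \<open>d\<close> the difference of the neutral and the charge-breaking \<open>r\<close>, one has \<open>L d = p\<close>, hence
  \<open>d \<bullet> L d = p \<bullet> d \<le> 0\<close>, which contradicts definiteness as \<open>d \<noteq> 0\<close>.\<close>

section \<open>Polarisation of the quadratic map from fields to \<open>rvec\<close>\<close>

definition pauli :: "4 \<Rightarrow> fields \<Rightarrow> fields" where
  "pauli \<mu> x = (if \<mu> = 0 then x
     else if \<mu> = 1 then (snd x, fst x)
     else if \<mu> = 2 then ((- \<i>) *s snd x, \<i> *s fst x)
     else (fst x, - snd x))"

text \<open>The matrices of \<open>pauli\<close> are the identity and the three Pauli matrices,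
  acting on the index that labels the doublets. They are self-adjoint for the real inner product of
  the eight fields, so \<open>polar\<close> is the symmetric bilinear form behind the quadratic map
  \<open>rvec\<close>.\<close>

definition polar :: "fields \<Rightarrow> fields \<Rightarrow> real ^ 4" where
  "polar x y = (\<chi> \<mu>. x \<bullet> pauli \<mu> y)"

text \<open>The adjoint of \<open>polar x\<close>; equally, the Hermitian 2 by 2 matrix with Pauli
  coordinates \<open>p\<close> applied to \<open>x\<close>.\<close>

definition polar_adj :: "fields \<Rightarrow> real ^ 4 \<Rightarrow> fields" where
  "polar_adj x p = (\<Sum>\<mu>\<in>UNIV. p $ \<mu> *\<^sub>R pauli \<mu> x)"

lemma sum_4_from_0: "(\<Sum>\<mu>\<in>UNIV. f (\<mu>::4)) = f 0 + f 1 + f 2 + f 3"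
proof -
  have 4: "(4::4) = 0" by simp
  show ?thesis unfolding sum_4 4 by (simp add: algebra_simps)
qed

lemma all_4_from_0: "(\<forall>\<mu>::4. P \<mu>) \<longleftrightarrow> P 0 \<and> P 1 \<and> P 2 \<and> P 3"
proof -
  have 4: "(4::4) = 0" by simp
  show ?thesis unfolding forall_4 4 by auto
qed

lemma pauli_simps:
  "pauli 0 x = x" "pauli 1 x = (snd x, fst x)"
  "pauli 2 x = ((- \<i>) *s snd x, \<i> *s fst x)" "pauli 3 x = (fst x, - snd x)"
  by (simp_all add: pauli_def)

lemma pauli_add: "pauli \<mu> (x + y) = pauli \<mu> x + pauli \<mu> y"
  and pauli_scaleR: "pauli \<mu> (c *\<^sub>R x) = c *\<^sub>R pauli \<mu> x"
  by (auto simp: pauli_def prod_eq_iff vec_eq_iff algebra_simps)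

lemma pauli_self_adjoint: "x \<bullet> pauli \<mu> y = pauli \<mu> x \<bullet> y"
  by (auto simp: pauli_def inner_prod_def inner_vec_def sum_2 inner_complex_def)

lemma inner_pauli_commute: "x \<bullet> pauli \<mu> y = y \<bullet> pauli \<mu> x"
  by (metis pauli_self_adjoint inner_commute)

lemma polar_commute: "polar x y = polar y x"
  unfolding polar_def by (subst inner_pauli_commute) (rule refl)

lemma bounded_bilinear_polar: "bounded_bilinear polar"
  unfolding bilinear_conv_bounded_bilinear [symmetric] bilinear_def
  by (intro conjI allI linearI)
    (simp_all add: polar_def vec_eq_iff pauli_add pauli_scaleR inner_add_left inner_add_right)

lemma bounded_bilinear_polar_adj: "bounded_bilinear polar_adj"
  unfolding bilinear_conv_bounded_bilinear [symmetric] bilinear_def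
  by (intro conjI allI linearI)
    (simp_all add: polar_adj_def pauli_add pauli_scaleR scaleR_add_right scaleR_add_left
      sum.distrib scaleR_sum_right mult.commute)

lemma polar_inner: "polar x v \<bullet> p = v \<bullet> polar_adj x p"
  unfolding polar_adj_def polar_def inner_sum_right
  by (simp add: inner_vec_def inner_pauli_commute [of x] mult.commute)

lemma rvec_eq_polar: "rvec x = polar x x"
  unfolding vec_eq_iff all_4_from_0 rvec_def polar_def Let_def
  by (simp add: pauli_simps dagger_def sum_2 inner_prod_def inner_vec_def inner_complex_def
      algebra_simps)

lemma has_derivative_rvec: "(rvec has_derivative (\<lambda>v. 2 *\<^sub>R polar x v)) (at x)"
proof -
  have "((\<lambda>x. polar x x) has_derivative (\<lambda>v. polar x v + polar v x)) (at x)"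
    by (rule bounded_bilinear.FDERIV [OF bounded_bilinear_polar]) auto
  then show ?thesis
    by (simp add: rvec_eq_polar [abs_def] polar_commute [of _ x] scaleR_2)
qed

section \<open>Gradient and Hessian of the potential\<close>

lemma quad_eq_inner: "quad \<Lambda> r = r \<bullet> (lower2 \<Lambda> *v r)"
  by (simp add: quad_def inner_vec_def matrix_vector_mult_def sum_distrib_left mult_ac)

lemma potential_eq:
  "potential M \<Lambda> x = - (lower M \<bullet> rvec x) + 1 / 2 * (rvec x \<bullet> (lower2 \<Lambda> *v rvec x))"
  by (simp add: potential_def quad_eq_inner inner_vec_def)

lemma transpose_lower2: "transpose (lower2 T) = lower2 (transpose T)"
proof -
  have "transpose metric = metric"
    by (auto simp: transpose_def metric_def vec_eq_iff)
  then show ?thesis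
    by (simp add: lower2_def matrix_transpose_mul matrix_mul_assoc)
qed

lemma inner_symmetric_matrix:
  fixes A :: "real ^ 'n ^ 'n"
  assumes "transpose A = A"
  shows "x \<bullet> (A *v y) = (A *v x) \<bullet> y"
  using dot_lmul_matrix[of x A y] assms
  by (metis transpose_matrix_vector)

text \<open>The gradient of the potential with respect to \<open>r\<close>.\<close>

definition slope :: "real ^ 4 \<Rightarrow> real ^ 4 ^ 4 \<Rightarrow> fields \<Rightarrow> real ^ 4" where
  "slope M \<Lambda> x = lower2 \<Lambda> *v rvec x - lower M"

text \<open>Chain rule: the derivative of \<open>rvec\<close> is twice \<open>polar x\<close>, whose
  adjoint carries the slope back to field space.\<close>

lemma GDERIV_potential:
  assumes "transpose \<Lambda> = \<Lambda>"
  shows "GDERIV (potential M \<Lambda>) x :> 2 *\<^sub>R polar_adj x (slope M \<Lambda> x)"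
proof -
  let ?L = "lower2 \<Lambda>"
  have sym: "rvec x \<bullet> (?L *v polar x v) = polar x v \<bullet> (?L *v rvec x)" for v
    by (subst inner_symmetric_matrix) (simp_all add: transpose_lower2 assms inner_commute)
  have "((\<lambda>x. - (lower M \<bullet> rvec x) + 1 / 2 * (rvec x \<bullet> (?L *v rvec x))) has_derivative
      (\<lambda>v. - (lower M \<bullet> (2 *\<^sub>R polar x v)) + 1 / 2 * (rvec x \<bullet> (?L *v (2 *\<^sub>R polar x v))
         + (2 *\<^sub>R polar x v) \<bullet> (?L *v rvec x)))) (at x)"
    by (intro derivative_intros has_derivative_rvec
        bounded_linear.has_derivative [OF matrix_vector_mul_bounded_linear])
  moreover have "- (lower M \<bullet> (2 *\<^sub>R polar x v)) + 1 / 2 * (rvec x \<bullet> (?L *v (2 *\<^sub>R polar x v))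
         + (2 *\<^sub>R polar x v) \<bullet> (?L *v rvec x)) = v \<bullet> (2 *\<^sub>R polar_adj x (slope M \<Lambda> x))" for v
    by (simp add: sym polar_inner [symmetric] slope_def inner_diff_right matrix_vector_mult_scaleR
        inner_commute [of "lower M"])
  ultimately show ?thesis
    by (simp add: gderiv_def potential_eq [abs_def])
qed

lemma GDERIV_unique: "GDERIV f x :> D \<Longrightarrow> GDERIV f x :> E \<Longrightarrow> D = E"
  unfolding gderiv_def by (metis has_derivative_unique vector_eq_ldot)

lemma gradient_potential:
  assumes "transpose \<Lambda> = \<Lambda>"
  shows "gradient (potential M \<Lambda>) x = 2 *\<^sub>R polar_adj x (slope M \<Lambda> x)"
  unfolding gradient_def
  using GDERIV_potential [OF assms] by (blast intro: the_equality GDERIV_unique)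

lemma stationary_potential:
  assumes "transpose \<Lambda> = \<Lambda>" and "stationary M \<Lambda> x"
  shows "polar_adj x (slope M \<Lambda> x) = 0"
proof -
  have "2 *\<^sub>R polar_adj x (slope M \<Lambda> x) = 0"
    using GDERIV_unique GDERIV_potential [OF assms(1)] assms(2) unfolding stationary_def by blast
  then show ?thesis by simp
qed

lemma hessian_potential:
  assumes "transpose \<Lambda> = \<Lambda>"
  shows "hessian (potential M \<Lambda>) x v =
    2 *\<^sub>R polar_adj v (slope M \<Lambda> x) + 4 *\<^sub>R polar_adj x (lower2 \<Lambda> *v polar x v)"
proof -
  let ?L = "lower2 \<Lambda>"
  have s: "(slope M \<Lambda> has_derivative (\<lambda>v. ?L *v (2 *\<^sub>R polar x v) - 0)) (at x)"
    unfolding slope_def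
    by (intro derivative_intros has_derivative_rvec
        bounded_linear.has_derivative [OF matrix_vector_mul_bounded_linear])
  have "((\<lambda>x. 2 *\<^sub>R polar_adj x (slope M \<Lambda> x)) has_derivative
     (\<lambda>v. 2 *\<^sub>R (polar_adj x (?L *v (2 *\<^sub>R polar x v) - 0) + polar_adj v (slope M \<Lambda> x)))) (at x)"
    by (intro has_derivative_scaleR_right bounded_bilinear.FDERIV [OF bounded_bilinear_polar_adj] s
        has_derivative_ident)
  then have "(gradient (potential M \<Lambda>) has_derivative
     (\<lambda>v. 2 *\<^sub>R (polar_adj x (?L *v (2 *\<^sub>R polar x v) - 0) + polar_adj v (slope M \<Lambda> x)))) (at x)"
    by (simp add: gradient_potential [OF assms, abs_def])
  then show ?thesis
    unfolding hessian_def
    by (simp add: frechet_derivative_at [symmetric] algebra_simps matrix_vector_mult_scaleR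
        bounded_bilinear.scaleR_right [OF bounded_bilinear_polar_adj])
qed

text \<open>Separates the two sources of curvature: directions with \<open>polar x v = 0\<close> see
  only the slope, and at zero slope only the quadratic form of \<Lambda> remains.\<close>

lemma inner_hessian_potential:
  assumes "transpose \<Lambda> = \<Lambda>"
  shows "v \<bullet> hessian (potential M \<Lambda>) x v =
    2 * (rvec v \<bullet> slope M \<Lambda> x) + 4 * (polar x v \<bullet> (lower2 \<Lambda> *v polar x v))"
  by (simp add: hessian_potential [OF assms] inner_add_right polar_inner rvec_eq_polar)

section \<open>Goldstone directions\<close>

lemma dagger_unitary:
  assumes "U \<in> U2"
  shows "dagger (U *v x) (U *v y) = dagger x y"
proof -
  have U: "conj_transpose U ** U = mat 1"
    using assms by (simp add: U2_def)
  have e: "(conj_transpose U ** U) $ i $ j = (mat 1 :: complex^2^2) $ i $ j" for i j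
    by (simp add: U)
  have e': "cnj (U $ 1 $ i) * U $ 1 $ j + cnj (U $ 2 $ i) * U $ 2 $ j = (if i = j then 1 else 0)" for i j
    using e[of i j] by (simp add: matrix_matrix_mult_def conj_transpose_def sum_2 mat_def)
  have "dagger (U *v x) (U *v y) =
     cnj (x $ 1) * y $ 1 * (cnj (U $ 1 $ 1) * U $ 1 $ 1 + cnj (U $ 2 $ 1) * U $ 2 $ 1) +
     cnj (x $ 1) * y $ 2 * (cnj (U $ 1 $ 1) * U $ 1 $ 2 + cnj (U $ 2 $ 1) * U $ 2 $ 2) +
     cnj (x $ 2) * y $ 1 * (cnj (U $ 1 $ 2) * U $ 1 $ 1 + cnj (U $ 2 $ 2) * U $ 2 $ 1) +
     cnj (x $ 2) * y $ 2 * (cnj (U $ 1 $ 2) * U $ 1 $ 2 + cnj (U $ 2 $ 2) * U $ 2 $ 2)"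
    by (simp add: dagger_def matrix_vector_mult_def sum_2 algebra_simps)
  also have "\<dots> = dagger x y"
    unfolding e' by (simp add: dagger_def sum_2)
  finally show ?thesis .
qed

text \<open>\<open>rvec\<close> is constant on an electroweak orbit, so its derivative vanishes
  along every curve in the orbit.\<close>

lemma polar_orbit_tangent:
  assumes "v \<in> orbit_tangent x"
  shows "polar x v = 0"
proof -
  obtain \<gamma> where \<gamma>: "\<And>t. \<gamma> t \<in> ew_orbit x" "\<gamma> 0 = x" "(\<gamma> has_vector_derivative v) (at 0)"
    using assms unfolding orbit_tangent_def by blast
  have const: "rvec (\<gamma> t) = rvec x" for t
    using \<gamma>(1)[of t] by (auto simp: ew_orbit_def rvec_def Let_def dagger_unitary)
  have "((rvec \<circ> \<gamma>) has_vector_derivative 2 *\<^sub>R polar x v) (at 0)"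
    by (rule vector_derivative_diff_chain_within)
      (use \<gamma> has_derivative_rvec [of x] in \<open>auto intro: has_derivative_at_withinI\<close>)
  then have "((\<lambda>t. rvec x) has_vector_derivative 2 *\<^sub>R polar x v) (at 0)"
    by (simp add: o_def const)
  then have "2 *\<^sub>R polar x v = 0"
    using vector_derivative_unique_at has_vector_derivative_const by blast
  then show ?thesis by simp
qed

section \<open>Linear algebra of the doublet pair and of semidefinite forms\<close>

lemma polar_adj_eq_0:
  assumes "polar_adj x p = 0"
  shows "complex_of_real (p $ 0 + p $ 3) * fst x $ i + Complex (p $ 1) (- p $ 2) * snd x $ i = 0"
    and "Complex (p $ 1) (p $ 2) * fst x $ i + complex_of_real (p $ 0 - p $ 3) * snd x $ i = 0"
proof -
  have "fst (polar_adj x p) $ i = 0" "snd (polar_adj x p) $ i = 0"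
    by (simp_all add: assms)
  then show "complex_of_real (p $ 0 + p $ 3) * fst x $ i + Complex (p $ 1) (- p $ 2) * snd x $ i = 0"
    and "Complex (p $ 1) (p $ 2) * fst x $ i + complex_of_real (p $ 0 - p $ 3) * snd x $ i = 0"
    unfolding polar_adj_def sum_4_from_0
    by (simp_all add: pauli_simps complex_eq_iff algebra_simps)
qed

definition fields_det :: "fields \<Rightarrow> complex" where
  "fields_det x = fst x $ 1 * snd x $ 2 - fst x $ 2 * snd x $ 1"

lemma charge_breaking_det: "charge_breaking x \<Longrightarrow> fields_det x \<noteq> 0"
proof
  assume cb: "charge_breaking x" and d: "fields_det x = 0"
  \<comment> \<open>In component \<open>k\<close> the two terms cancel identically; the other
    component is the determinant up to sign.\<close>
  have dep: "snd x $ k *s fst x + (- (fst x $ k)) *s snd x = 0" for k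
    using d exhaust_2[of k] by (auto simp: fields_det_def vec_eq_iff forall_2 algebra_simps)
  have "fst x $ k = 0" for k
    using cb dep[of k] unfolding charge_breaking_def by fastforce
  then have "1 *s fst x + 0 *s snd x = 0"
    by (simp add: vec_eq_iff)
  then show False
    using cb unfolding charge_breaking_def by fastforce
qed

lemma neutral_det: "neutral x \<Longrightarrow> fields_det x = 0"
  by (auto simp: neutral_def fields_det_def)

text \<open>Lagrange's identity for the Gram determinant of the doublets. It places
  \<open>rvec x\<close> inside the light-cone, and on its boundary exactly when the determinant
  vanishes.\<close>

lemma minkowski_rvec:
  "(rvec x $ 0)\<^sup>2 - (rvec x $ 1)\<^sup>2 - (rvec x $ 2)\<^sup>2 - (rvec x $ 3)\<^sup>2 = 4 * (cmod (fields_det x))\<^sup>2"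
  unfolding cmod_power2 rvec_def Let_def
  by (simp add: dagger_def sum_2 fields_det_def power2_eq_square algebra_simps)

lemma rvec_0: "rvec x $ 0 = (norm x)\<^sup>2"
  by (simp add: rvec_eq_polar polar_def pauli_simps power2_norm_eq_inner)

text \<open>Each row of the Hermitian matrix of \<open>p\<close> is a linear relation between
  independent doublets, so all its entries vanish.\<close>

lemma polar_adj_inj:
  assumes "charge_breaking x" and "polar_adj x p = 0"
  shows "p = 0"
proof -
  let ?a = "fst x" and ?b = "snd x"
  have li: "c = 0 \<and> d = 0" if "\<And>i. c * ?a $ i + d * ?b $ i = 0" for c d
  proof -
    have "c *s ?a + d *s ?b = 0"
      using that by (simp add: vec_eq_iff)
    then show ?thesis
      using assms(1) unfolding charge_breaking_def by blast
  qed
  have "complex_of_real (p $ 0 + p $ 3) = 0" and C: "Complex (p $ 1) (- p $ 2) = 0"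
    using li [OF polar_adj_eq_0(1) [OF assms(2)]] by blast+
  then have "p $ 0 + p $ 3 = 0"
    by (simp only: of_real_eq_0_iff)
  moreover have "complex_of_real (p $ 0 - p $ 3) = 0"
    using li [OF polar_adj_eq_0(2) [OF assms(2)]] by blast
  then have "p $ 0 - p $ 3 = 0"
    by (simp only: of_real_eq_0_iff)
  moreover have "p $ 1 = 0" "p $ 2 = 0"
    using C by (simp_all add: complex_eq_iff)
  ultimately show ?thesis
    unfolding vec_eq_iff all_4_from_0 zero_index by linarith
qed

text \<open>A linear map is onto when its adjoint is injective; this is the submersion property of
  \<open>rvec\<close> at \<open>x\<close>.\<close>

lemma polar_surj:
  assumes "charge_breaking x"
  shows "surj (polar x)"
proof -
  interpret P: bounded_bilinear polar by (rule bounded_bilinear_polar)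
  interpret Q: bounded_bilinear polar_adj by (rule bounded_bilinear_polar_adj)
  have lin: "linear (polar x)"
    by (intro linearI P.add_right P.scaleR_right)
  have "adjoint (polar x) = polar_adj x"
    by (rule adjoint_unique) (simp add: polar_inner)
  moreover have "inj (polar_adj x)"
    using polar_adj_inj [OF assms] by (metis Q.diff_right eq_iff_diff_eq_0 injI)
  ultimately show ?thesis
    using inj_adjoint_iff_surj [OF lin] by simp
qed

lemma psd_kernel:
  fixes A :: "real ^ 'n ^ 'n"
  assumes sym: "transpose A = A" and psd: "\<And>w. w \<bullet> (A *v w) \<ge> 0" and w: "w \<bullet> (A *v w) = 0"
  shows "A *v w = 0"
proof -
  let ?u = "A *v w"
  let ?k = "?u \<bullet> (A *v ?u)"
  define U where "U = ?u \<bullet> ?u"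
  \<comment> \<open>Moving from \<open>w\<close> by \<open>t\<close> times \<open>A *v w\<close>
    changes the form from 0 to \<open>2 * t * U + t\<^sup>2 * ?k\<close>. This \<open>t\<close>
    makes it negative unless \<open>U = 0\<close>; the added 1 keeps the denominator positive when
    \<open>?k\<close> is zero.\<close>
  define t where "t = - U / (?k + 1)"
  have k: "?k \<ge> 0" by (rule psd)
  have "0 \<le> (w + t *\<^sub>R ?u) \<bullet> (A *v (w + t *\<^sub>R ?u))" by (rule psd)
  also have "\<dots> = w \<bullet> ?u + t * (w \<bullet> (A *v ?u)) + t * (?u \<bullet> ?u) + t\<^sup>2 * ?k"
    by (simp only: matrix_vector_right_distrib matrix_vector_mult_scaleR inner_add_left
        inner_add_right inner_scaleR_left inner_scaleR_right power2_eq_square)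
      (simp only: algebra_simps)
  also have "w \<bullet> (A *v ?u) = U"
    unfolding U_def by (rule inner_symmetric_matrix [OF sym])
  finally have "0 \<le> 2 * t * U + t\<^sup>2 * ?k"
    using w by (simp add: U_def)
  also have "\<dots> = - (U\<^sup>2 * ((?k + 2) / (?k + 1)\<^sup>2))"
  proof -
    have "2 * (- U / (k + 1)) * U + (- U / (k + 1))\<^sup>2 * k = - (U\<^sup>2 * ((k + 2) / (k + 1)\<^sup>2))"
      if "k \<ge> 0" for k :: real
      using that by (simp add: divide_simps) (simp add: algebra_simps power2_eq_square)
    then show ?thesis
      unfolding t_def using k by blast
  qed
  finally have "U\<^sup>2 * ((?k + 2) / (?k + 1)\<^sup>2) \<le> 0"
    by (simp only: neg_0_le_iff_le)
  moreover have "(?k + 2) / (?k + 1)\<^sup>2 > 0"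
    using k by (intro divide_pos_pos zero_less_power) linarith+
  ultimately have "U\<^sup>2 \<le> 0"
    by (metis mult_le_0_iff not_le)
  then show ?thesis
    by (simp add: U_def)
qed

section \<open>Consequences of minimality at the two kinds of point\<close>

lemma charge_breaking_minimum:
  assumes sym: "transpose \<Lambda> = \<Lambda>" and cb: "charge_breaking x" and min: "is_minimum M \<Lambda> x"
  shows "slope M \<Lambda> x = 0" and "w \<noteq> 0 \<Longrightarrow> w \<bullet> (lower2 \<Lambda> *v w) > 0"
proof -
  interpret Q: bounded_bilinear polar_adj by (rule bounded_bilinear_polar_adj)
  let ?L = "lower2 \<Lambda>"
  have symL: "transpose ?L = ?L" by (simp add: transpose_lower2 sym)
  have "stationary M \<Lambda> x" and psdH: "\<And>v. v \<bullet> hessian (potential M \<Lambda>) x v \<ge> 0"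
    and ker: "{v. hessian (potential M \<Lambda>) x v = 0} = orbit_tangent x"
    using min unfolding is_minimum_def by auto
  then show p0: "slope M \<Lambda> x = 0"
    using stationary_potential [OF sym] polar_adj_inj [OF cb] by blast
  have psd: "w \<bullet> (?L *v w) \<ge> 0" for w
  proof -
    obtain v where "w = polar x v" using polar_surj [OF cb] by (meson surjD)
    then show ?thesis
      using psdH[of v] by (simp add: inner_hessian_potential [OF sym] p0)
  qed
  show "w \<bullet> (?L *v w) > 0" if "w \<noteq> 0"
  proof (rule ccontr)
    assume "\<not> w \<bullet> (?L *v w) > 0"
    then have "w \<bullet> (?L *v w) = 0" using psd[of w] by simp
    then have Lw: "?L *v w = 0" by (rule psd_kernel [OF symL psd])
    \<comment> \<open>A null vector of the form lifts to a zero mode of the Hessian. At a minimum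
      such a mode is tangent to the orbit, where \<open>polar x\<close> vanishes, forcing
      \<open>w = 0\<close>.\<close>
    obtain v where v: "w = polar x v" using polar_surj [OF cb] by (meson surjD)
    have "hessian (potential M \<Lambda>) x v = 0"
      using Lw by (simp add: hessian_potential [OF sym] p0 Q.zero_right flip: v)
    then have "v \<in> orbit_tangent x" using ker by auto
    then show False
      using polar_orbit_tangent v that by metis
  qed
qed

lemma neutral_minimum_slope:
  assumes sym: "transpose \<Lambda> = \<Lambda>" and neu: "neutral x" and min: "is_minimum M \<Lambda> x"
  defines "p \<equiv> slope M \<Lambda> x"
  shows "p $ 0 \<ge> 0" and "(p $ 0)\<^sup>2 = (p $ 1)\<^sup>2 + (p $ 2)\<^sup>2 + (p $ 3)\<^sup>2"
    and "rvec x \<bullet> p = 0"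
proof -
  let ?a = "fst x" and ?b = "snd x"
  have "stationary M \<Lambda> x" and psdH: "\<And>v. v \<bullet> hessian (potential M \<Lambda>) x v \<ge> 0"
    using min unfolding is_minimum_def by auto
  then have p: "polar_adj x p = 0"
    unfolding p_def using stationary_potential [OF sym] by blast
  then show rp: "rvec x \<bullet> p = 0"
    by (simp add: rvec_eq_polar polar_inner)
  have x0: "x \<noteq> 0" using neu by (simp add: neutral_def)
  have det: "fields_det x = 0" by (rule neutral_det [OF neu])
  \<comment> \<open>The cofactor configuration is orthogonal to both doublets, and its \<open>rvec\<close> is the
    parity reflection of that of \<open>x\<close>.\<close>
  define v :: fields where
    "v = (vector [cnj (?b $ 2), - cnj (?b $ 1)], vector [- cnj (?a $ 2), cnj (?a $ 1)])"
  have rv: "rvec v $ 0 = rvec x $ 0" "rvec v $ 1 = - rvec x $ 1"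
      "rvec v $ 2 = - rvec x $ 2" "rvec v $ 3 = - rvec x $ 3"
    unfolding v_def rvec_def dagger_def Let_def by (simp_all add: sum_2 algebra_simps)
  have "polar x v = 0"
    using det unfolding vec_eq_iff all_4_from_0 v_def polar_def fields_det_def
    by (simp add: pauli_simps sum_2 inner_prod_def inner_vec_def inner_complex_def
        complex_eq_iff algebra_simps)
  \<comment> \<open>With \<open>polar x v = 0\<close> the Hessian in direction \<open>v\<close>
    reduces to the slope term.\<close>
  then have "rvec v \<bullet> p \<ge> 0"
    using psdH[of v] by (simp add: inner_hessian_potential [OF sym] p_def)
  \<comment> \<open>Adding \<open>rvec x \<bullet> p = 0\<close> to the reflected product cancels
    the spatial parts and leaves twice the time part.\<close>
  with rp rv have "rvec x $ 0 * p $ 0 \<ge> 0"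
    by (simp add: inner_vec_def sum_4_from_0)
  then show "p $ 0 \<ge> 0"
    using x0 by (simp add: rvec_0 zero_le_mult_iff)
  let ?A = "complex_of_real (p $ 0 + p $ 3)" and ?D = "complex_of_real (p $ 0 - p $ 3)"
    and ?C = "Complex (p $ 1) (- p $ 2)" and ?C' = "Complex (p $ 1) (p $ 2)"
  \<comment> \<open>Eliminating between the two rows shows that the determinant of the Hermitian
    matrix of \<open>p\<close> annihilates every field component. As \<open>x\<close> is nonzero the
    determinant vanishes, and it is the Minkowski square of \<open>p\<close>.\<close>
  have e: "(?A * ?D - ?C * ?C') * ?a $ i = 0" "(?A * ?D - ?C * ?C') * ?b $ i = 0" for i
    using polar_adj_eq_0 [OF p, of i] by algebra+
  have "?A * ?D - ?C * ?C' = 0"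
  proof (rule ccontr)
    assume "?A * ?D - ?C * ?C' \<noteq> 0"
    then have "x = 0" using e by (simp add: prod_eq_iff vec_eq_iff)
    with x0 show False by simp
  qed
  then show "(p $ 0)\<^sup>2 = (p $ 1)\<^sup>2 + (p $ 2)\<^sup>2 + (p $ 3)\<^sup>2"
    by (simp add: complex_eq_iff power2_eq_square algebra_simps)
qed

section \<open>Light-cone geometry and the contradiction\<close>

lemma cauchy_schwarz_3:
  fixes a b c x y z :: real
  shows "(a * x + b * y + c * z)\<^sup>2 \<le> (a\<^sup>2 + b\<^sup>2 + c\<^sup>2) * (x\<^sup>2 + y\<^sup>2 + z\<^sup>2)"
proof -
  have "(a\<^sup>2 + b\<^sup>2 + c\<^sup>2) * (x\<^sup>2 + y\<^sup>2 + z\<^sup>2) - (a * x + b * y + c * z)\<^sup>2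
      = (a * y - b * x)\<^sup>2 + (a * z - c * x)\<^sup>2 + (b * z - c * y)\<^sup>2"
    by (simp add: power2_eq_square algebra_simps)
  also have "\<dots> \<ge> 0" by simp
  finally show ?thesis by simp
qed

text \<open>Self-duality of the cone: by Cauchy-Schwarz the spatial product cannot outweigh the time
  product. The pairing is Euclidean because the slope is a covector, with its index already
  lowered.\<close>

lemma light_cone_inner_nonneg:
  fixes p q :: "real ^ 4"
  assumes "p $ 0 \<ge> 0" and "(p $ 1)\<^sup>2 + (p $ 2)\<^sup>2 + (p $ 3)\<^sup>2 \<le> (p $ 0)\<^sup>2"
    and "q $ 0 \<ge> 0" and "(q $ 1)\<^sup>2 + (q $ 2)\<^sup>2 + (q $ 3)\<^sup>2 \<le> (q $ 0)\<^sup>2"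
  shows "p \<bullet> q \<ge> 0"
proof -
  let ?s = "p $ 1 * q $ 1 + p $ 2 * q $ 2 + p $ 3 * q $ 3"
  have "?s\<^sup>2 \<le> ((p $ 1)\<^sup>2 + (p $ 2)\<^sup>2 + (p $ 3)\<^sup>2) * ((q $ 1)\<^sup>2 + (q $ 2)\<^sup>2 + (q $ 3)\<^sup>2)"
    by (rule cauchy_schwarz_3)
  also have "\<dots> \<le> (p $ 0)\<^sup>2 * (q $ 0)\<^sup>2"
    using assms by (intro mult_mono) auto
  finally have "\<bar>?s\<bar> \<le> p $ 0 * q $ 0"
    using assms by (metis abs_le_square_iff abs_of_nonneg mult_nonneg_nonneg power_mult_distrib)
  then show ?thesis
    by (simp add: inner_vec_def sum_4_from_0)
qed

theorem proposition5:
  fixes M :: "real ^ 4" and \<Lambda> :: "real ^ 4 ^ 4"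
  assumes "transpose \<Lambda> = \<Lambda>"
    and "positivity \<Lambda>"
  shows "\<not> ((\<exists>\<Phi>. charge_breaking \<Phi> \<and> is_minimum M \<Lambda> \<Phi>)
            \<and> (\<exists>\<Psi>. neutral \<Psi> \<and> is_minimum M \<Lambda> \<Psi>))"
proof clarify
  fix \<Phi> \<Psi>
  assume \<Phi>: "charge_breaking \<Phi>" "is_minimum M \<Lambda> \<Phi>" and \<Psi>: "neutral \<Psi>" "is_minimum M \<Lambda> \<Psi>"
  let ?p = "slope M \<Lambda> \<Psi>" and ?d = "rvec \<Psi> - rvec \<Phi>"
  note cb = charge_breaking_minimum [OF assms(1) \<Phi>]
  note neu = neutral_minimum_slope [OF assms(1) \<Psi>]
  have det: "fields_det \<Phi> \<noteq> 0" "fields_det \<Psi> = 0"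
    using charge_breaking_det \<Phi>(1) neutral_det \<Psi>(1) by auto
  \<comment> \<open>The Minkowski square is positive at \<Phi> and zero at \<Psi>.\<close>
  have "?d \<noteq> 0"
    using minkowski_rvec[of \<Phi>] minkowski_rvec[of \<Psi>] det by auto
  then have "?d \<bullet> (lower2 \<Lambda> *v ?d) > 0" by (rule cb(2))
  \<comment> \<open>Zero slope at \<Phi> says that \<open>lower2 \<Lambda> *v rvec \<Phi>\<close>
    equals \<open>lower M\<close>.\<close>
  moreover have "lower2 \<Lambda> *v ?d = ?p"
    using cb(1) by (simp add: slope_def matrix_vector_mult_diff_distrib)
  \<comment> \<open>Since \<open>?p\<close> is orthogonal to \<open>rvec \<Psi>\<close>, only the
    \<Phi> part of \<open>?d\<close> contributes, with a minus sign.\<close>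
  ultimately have "?p \<bullet> rvec \<Phi> < 0"
    using neu(3) by (simp add: inner_diff_left inner_commute [of ?p])
  moreover have "?p \<bullet> rvec \<Phi> \<ge> 0"
  proof (rule light_cone_inner_nonneg)
    show "rvec \<Phi> $ 0 \<ge> 0"
      by (simp add: rvec_0)
    have "0 \<le> 4 * (cmod (fields_det \<Phi>))\<^sup>2" by simp
    then show "(rvec \<Phi> $ 1)\<^sup>2 + (rvec \<Phi> $ 2)\<^sup>2 + (rvec \<Phi> $ 3)\<^sup>2 \<le> (rvec \<Phi> $ 0)\<^sup>2"
      unfolding minkowski_rvec [symmetric] by linarith
  qed (use neu in simp_all)
  ultimately show False by simp
qed

end
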